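(* Let $p,q$ be positive integers, $n=p+q+1$ and $a>1$. Let $\mathcal{X}=\sum_{i=1}^{n}R_i\frac{\partial}{\partial x_i}$ be a degree one polynomial vector field defined on $S_{p,q}$, where $$R_i=\sum_{j=1}^{n}c_{ij}x_j+c_{i0},\qquad c_{ij}\in\mathbb{R},\quad i=1,\ldots,n,\ j=0,\ldots,n.$$ Then the $(p+1)\times(p+1)$ matrix $(c_{ij})_{1\le i,j\le p+1}$ is skew-symmetric, and $c_{i0}=0$ for all $i\in\{1,\ldots,n\}$.
   Context: $S_{p,q}\subset\mathbb{R}^n$ is the hypersurface $\{h=0\}$, where $h=\left(\sum_{i=1}^{p+1}x_i^2-a^2\right)^2+\sum_{j=p+2}^{n}x_j^2-1$. For $R_1,\ldots,R_n\in\mathbb{R}[x_1,\ldots,x_n]$, the polynomial vector field $\mathcal{X}=\sum_i R_i\,\partial/\partial x_i$ (also written $(R_1,\ldots,R_n)$) has degree $\max_i\deg R_i$. It is said to be defined on $S_{p,q}$ (equivalently, $S_{p,q}$ is invariant for it) if $\mathcal{X}h=Kh$ for some $K\in\mathbb{R}[x_1,\ldots,x_n]$, called the cofactor. *)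

theory Defs
  imports Complex_Main "HOL-Library.Poly_Mapping"
begin

text \<open>
  Real polynomials in variables indexed by the natural numbers: a finitely supported map from
  monomials (finitely supported exponent vectors) to coefficients, with the convolution product
  of \<^theory>\<open>HOL-Library.Poly_Mapping\<close>.
\<close>

type_synonym rpoly = "(nat \<Rightarrow>\<^sub>0 nat) \<Rightarrow>\<^sub>0 real"

definition Cst :: "real \<Rightarrow> rpoly" where
  "Cst c = Poly_Mapping.single 0 c"

definition Var :: "nat \<Rightarrow> rpoly" where
  "Var i = Poly_Mapping.single (Poly_Mapping.single i 1) 1"

text \<open>The subring of polynomials that only involve the variables with indices \<open>1, \<dots>, n\<close>.\<close>

definition poly_ring :: "nat \<Rightarrow> rpoly set" where
  "poly_ring n = {f. \<forall>m\<in>Poly_Mapping.keys f. Poly_Mapping.keys m \<subseteq> {1..n}}"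

text \<open>The zero polynomial gets degree \<open>0\<close>.\<close>

definition total_degree :: "rpoly \<Rightarrow> nat" where
  "total_degree f =
     Max (insert 0 ((\<lambda>m. \<Sum>i\<in>Poly_Mapping.keys m. Poly_Mapping.lookup m i) ` Poly_Mapping.keys f))"

text \<open>
  Where the variable \<open>i\<close> does not occur in \<open>m\<close>, the truncated difference of exponents is harmless,
  because the new coefficient is \<open>0\<close>.
\<close>

definition partial_deriv :: "nat \<Rightarrow> rpoly \<Rightarrow> rpoly" where
  "partial_deriv i f =
     (\<Sum>m\<in>Poly_Mapping.keys f.
        Poly_Mapping.single (m - Poly_Mapping.single i 1)
          (of_nat (Poly_Mapping.lookup m i) * Poly_Mapping.lookup f m))"

text \<open>
  A vector field on \<open>n\<close>-space is the family \<open>R\<close> of its components, of which only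
  \<open>R 1, \<dots>, R n\<close> matter.
\<close>

definition polynomial_vector_field :: "nat \<Rightarrow> (nat \<Rightarrow> rpoly) \<Rightarrow> bool" where
  "polynomial_vector_field n R \<longleftrightarrow> (\<forall>i\<in>{1..n}. R i \<in> poly_ring n)"

definition vf_degree :: "nat \<Rightarrow> (nat \<Rightarrow> rpoly) \<Rightarrow> nat" where
  "vf_degree n R = Max ((\<lambda>i. total_degree (R i)) ` {1..n})"

definition vf_apply :: "nat \<Rightarrow> (nat \<Rightarrow> rpoly) \<Rightarrow> rpoly \<Rightarrow> rpoly" where
  "vf_apply n R f = (\<Sum>i=1..n. R i * partial_deriv i f)"

definition h_poly :: "nat \<Rightarrow> nat \<Rightarrow> real \<Rightarrow> rpoly" where
  "h_poly p q a =
     ((\<Sum>i=1..p+1. Var i ^ 2) - Cst (a ^ 2)) ^ 2 + (\<Sum>j=p+2..p+q+1. Var j ^ 2) - 1"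

text \<open>The vector field leaves the hypersurface \<open>h = 0\<close> invariant; \<open>K\<close> is its cofactor.\<close>

definition vf_defined_on_S :: "nat \<Rightarrow> nat \<Rightarrow> real \<Rightarrow> (nat \<Rightarrow> rpoly) \<Rightarrow> bool" where
  "vf_defined_on_S p q a R \<longleftrightarrow>
     (\<exists>K\<in>poly_ring (p+q+1). vf_apply (p+q+1) R (h_poly p q a) = K * h_poly p q a)"

end

theory Submission
  imports Defs
begin

text \<open>
  Write a point of \<open>n\<close>-space as \<open>(x, y)\<close> with \<open>x\<close> the first \<open>p + 1\<close> and \<open>y\<close> the last \<open>q\<close>
  coordinates, and put \<open>u = |x|\<^sup>2 - a\<^sup>2\<close>, so that \<open>h = u\<^sup>2 + |y|\<^sup>2 - 1\<close>. The identity
  \<open>Xh = Kh\<close> forces \<open>Xh\<close> to vanish at every real point of the hypersurface. There it says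
  that \<open>2u (R\<^sub>x \<bullet> x) + R\<^sub>y \<bullet> y = 0\<close>, where \<open>R\<^sub>x\<close> and \<open>R\<^sub>y\<close> are the corresponding blocks
  of \<open>X\<close> (\<open>tangency_on_S\<close>). Two families of points suffice to read off the claim.

  \<^item> If \<open>y = 0\<close> and \<open>|x|\<^sup>2 = a\<^sup>2 + 1\<close>, then \<open>u = 1\<close>, and what remains is
    \<open>x \<bullet> Ax + b \<bullet> x = 0\<close>, with \<open>A\<close> the upper left block of \<open>(c\<^sub>i\<^sub>j)\<close> and \<open>b\<close> the constant
    terms of \<open>R\<^sub>x\<close>. Comparing \<open>x\<close> with \<open>-x\<close> separates the two summands: the quadratic
    form of \<open>A\<close> vanishes on a sphere, so \<open>A\<close> is skew-symmetric, and \<open>b = 0\<close>.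
  \<^item> If \<open>|x| = a\<close> and \<open>|y| = 1\<close>, then \<open>u = 0\<close> and \<open>R\<^sub>y \<bullet> y = 0\<close>. The part of this identity
    that is even in \<open>x\<close> and odd in \<open>y\<close> is the product of \<open>y\<close> with the constant terms
    of \<open>R\<^sub>y\<close>, which are therefore zero.

  Points with at most two nonzero coordinates are enough in both cases. The passage from formal
  polynomials to real points rests on evaluation being a ring homomorphism
  (\<open>poly_eval_add\<close>, \<open>poly_eval_mult\<close>) that turns formal partial derivatives into real ones
  (\<open>poly_eval_partial_deriv\<close>).
\<close>

section \<open>Evaluation of polynomials at real points\<close>

definition mono_eval :: "(nat \<Rightarrow> real) \<Rightarrow> (nat \<Rightarrow>\<^sub>0 nat) \<Rightarrow> real" where
  "mono_eval v m = (\<Prod>i\<in>Poly_Mapping.keys m. v i ^ Poly_Mapping.lookup m i)"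

definition poly_eval :: "(nat \<Rightarrow> real) \<Rightarrow> rpoly \<Rightarrow> real" where
  "poly_eval v f = (\<Sum>m\<in>Poly_Mapping.keys f. Poly_Mapping.lookup f m * mono_eval v m)"

text \<open>
  Enlarging the index set to a common superset allows monomials, and below polynomials, with
  different supports to be compared term by term.
\<close>

lemma mono_eval_superset:
  assumes "finite S" "Poly_Mapping.keys m \<subseteq> S"
  shows "mono_eval v m = (\<Prod>i\<in>S. v i ^ Poly_Mapping.lookup m i)"
  unfolding mono_eval_def
  by (rule prod.mono_neutral_left) (use assms in \<open>auto simp: in_keys_iff\<close>)

lemma mono_eval_add: "mono_eval v (m + m') = mono_eval v m * mono_eval v m'"
proof -
  let ?S = "Poly_Mapping.keys m \<union> Poly_Mapping.keys m'"
  have "mono_eval v (m + m') = (\<Prod>i\<in>?S. v i ^ Poly_Mapping.lookup (m + m') i)"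
    by (rule mono_eval_superset) (use Poly_Mapping.keys_add[of m m'] in auto)
  also have "\<dots> = (\<Prod>i\<in>?S. v i ^ Poly_Mapping.lookup m i) * (\<Prod>i\<in>?S. v i ^ Poly_Mapping.lookup m' i)"
    by (simp add: lookup_add power_add prod.distrib)
  also have "\<dots> = mono_eval v m * mono_eval v m'"
    by (simp add: mono_eval_superset[of ?S])
  finally show ?thesis .
qed

lemma poly_eval_superset:
  assumes "finite S" "Poly_Mapping.keys f \<subseteq> S"
  shows "poly_eval v f = (\<Sum>m\<in>S. Poly_Mapping.lookup f m * mono_eval v m)"
  unfolding poly_eval_def
  by (rule sum.mono_neutral_left) (use assms in \<open>auto simp: in_keys_iff\<close>)

lemma poly_eval_zero [simp]: "poly_eval v 0 = 0"
  by (simp add: poly_eval_def)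

lemma poly_eval_add [simp]: "poly_eval v (f + g) = poly_eval v f + poly_eval v g"
proof -
  let ?S = "Poly_Mapping.keys f \<union> Poly_Mapping.keys g"
  have "poly_eval v (f + g) = (\<Sum>m\<in>?S. Poly_Mapping.lookup (f + g) m * mono_eval v m)"
    by (rule poly_eval_superset) (use Poly_Mapping.keys_add[of f g] in auto)
  also have "\<dots> = poly_eval v f + poly_eval v g"
    by (simp add: poly_eval_superset[of ?S] lookup_add distrib_right sum.distrib)
  finally show ?thesis .
qed

lemma poly_eval_diff [simp]: "poly_eval v (f - g) = poly_eval v f - poly_eval v g"
  using poly_eval_add[of v "f - g" g] by simp

lemma poly_eval_sum [simp]: "poly_eval v (sum f A) = (\<Sum>i\<in>A. poly_eval v (f i))"
  by (induction A rule: infinite_finite_induct) auto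

lemma poly_eval_single: "poly_eval v (Poly_Mapping.single m c) = c * mono_eval v m"
  by (simp add: poly_eval_def)

lemma poly_mapping_eq_sum_single:
  "(\<Sum>m\<in>Poly_Mapping.keys f. Poly_Mapping.single m (Poly_Mapping.lookup f m)) = f"
  by (rule poly_mapping_eqI)
     (auto simp: lookup_sum lookup_single when_def in_keys_iff cong: sum.cong)

lemma poly_eval_mult [simp]: "poly_eval v (f * g) = poly_eval v f * poly_eval v g"
proof -
  let ?s = "\<lambda>f m. Poly_Mapping.single m (Poly_Mapping.lookup f m)"
  have "poly_eval v (f * g) = poly_eval v ((\<Sum>m\<in>Poly_Mapping.keys f. ?s f m) * (\<Sum>m\<in>Poly_Mapping.keys g. ?s g m))"
    by (simp only: poly_mapping_eq_sum_single)
  also have "\<dots> = (\<Sum>m\<in>Poly_Mapping.keys f. \<Sum>m'\<in>Poly_Mapping.keys g. poly_eval v (?s f m * ?s g m'))"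
    by (simp only: sum_product poly_eval_sum)
  also have "\<dots> = poly_eval v f * poly_eval v g"
    by (simp only: mult_single poly_eval_single mono_eval_add)
       (simp add: poly_eval_def sum_product ac_simps)
  finally show ?thesis .
qed

lemma poly_eval_Cst [simp]: "poly_eval v (Cst c) = c"
  by (simp add: Cst_def poly_eval_single mono_eval_def)

lemma poly_eval_one [simp]: "poly_eval v 1 = 1"
  using poly_eval_Cst[of v 1] by (simp add: Cst_def flip: single_one)

lemma poly_eval_Var [simp]: "poly_eval v (Var i) = v i"
  by (simp add: Var_def poly_eval_single mono_eval_def)

lemma poly_eval_power [simp]: "poly_eval v (f ^ k) = poly_eval v f ^ k"
  by (induction k) auto

text \<open>
  Both sides are linear in the polynomial, so only monomials matter, and there the variable \<open>i\<close>
  splits off as a power \<open>t ^ k\<close> times a factor \<open>M\<close> independent of \<open>t\<close>. This way the partial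
  derivatives of a concrete polynomial can be computed by calculus, without a Leibniz rule for
  formal polynomials.
\<close>

lemma poly_eval_partial_deriv:
  "((\<lambda>t. poly_eval (v(i := t)) f) has_real_derivative poly_eval v (partial_deriv i f)) (at (v i))"
proof -
  define M where "M m = (\<Prod>j\<in>Poly_Mapping.keys m - {i}. v j ^ Poly_Mapping.lookup m j)" for m
  have factor: "mono_eval (v(i := t)) m = t ^ Poly_Mapping.lookup m i * M m" for t m
  proof -
    have "mono_eval (v(i := t)) m
        = (\<Prod>j\<in>insert i (Poly_Mapping.keys m). (v(i := t)) j ^ Poly_Mapping.lookup m j)"
      by (rule mono_eval_superset) auto
    then show ?thesis
      by (simp add: prod.insert_remove M_def)
  qed
  have M_shift: "M (m - Poly_Mapping.single i 1) = M m" for m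
  proof -
    have "Poly_Mapping.keys (m - Poly_Mapping.single i 1) - {i} = Poly_Mapping.keys m - {i}"
      by (auto simp: in_keys_iff lookup_minus lookup_single)
    then show ?thesis
      unfolding M_def by (intro prod.cong) (auto simp: lookup_minus lookup_single)
  qed
  have factor': "mono_eval v m = v i ^ Poly_Mapping.lookup m i * M m" for m
    using factor[of "v i" m] by simp
  have "poly_eval v (partial_deriv i f)
      = (\<Sum>m\<in>Poly_Mapping.keys f. Poly_Mapping.lookup f m *
          (of_nat (Poly_Mapping.lookup m i) * v i ^ (Poly_Mapping.lookup m i - 1) * M m))"
    unfolding partial_deriv_def
    by (simp add: poly_eval_single factor' M_shift lookup_minus lookup_single ac_simps
        del: One_nat_def)
  then show ?thesis
    unfolding poly_eval_def factor
    by (auto intro!: derivative_eq_intros sum.cong)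
qed

section \<open>Tangency along the hypersurface\<close>

lemma poly_eval_h_poly:
  "poly_eval v (h_poly p q a)
   = ((\<Sum>i=1..p+1. v i ^ 2) - a ^ 2) ^ 2 + (\<Sum>j=p+2..p+q+1. v j ^ 2) - 1"
  by (simp add: h_poly_def del: sum.cl_ivl_Suc)

lemma has_derivative_sum_squares:
  fixes v :: "nat \<Rightarrow> real"
  assumes "finite A"
  shows "((\<lambda>t. \<Sum>j\<in>A. (v(i := t)) j ^ 2) has_real_derivative (if i \<in> A then 2 * v i else 0))
    (at (v i))"
proof -
  have "((\<lambda>t. (v(i := t)) j ^ 2) has_real_derivative (if j = i then 2 * v i else 0)) (at (v i))" for j
    by (cases "j = i") (auto intro!: derivative_eq_intros)
  then have "((\<lambda>t. \<Sum>j\<in>A. (v(i := t)) j ^ 2) has_real_derivative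
      (\<Sum>j\<in>A. if j = i then 2 * v i else 0)) (at (v i))"
    by (intro DERIV_sum) auto
  then show ?thesis
    using assms by simp
qed

lemma poly_eval_partial_deriv_h_poly:
  "poly_eval v (partial_deriv i (h_poly p q a))
   = (if i \<in> {1..p+1} then 4 * ((\<Sum>k=1..p+1. v k ^ 2) - a ^ 2) * v i else 0)
     + (if i \<in> {p+2..p+q+1} then 2 * v i else 0)"
proof (rule DERIV_unique)
  show "((\<lambda>t. poly_eval (v(i := t)) (h_poly p q a)) has_real_derivative
      poly_eval v (partial_deriv i (h_poly p q a))) (at (v i))"
    by (rule poly_eval_partial_deriv)
  show "((\<lambda>t. poly_eval (v(i := t)) (h_poly p q a)) has_real_derivative
      (if i \<in> {1..p+1} then 4 * ((\<Sum>k=1..p+1. v k ^ 2) - a ^ 2) * v i else 0)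
       + (if i \<in> {p+2..p+q+1} then 2 * v i else 0)) (at (v i))"
    unfolding poly_eval_h_poly
    by (rule derivative_eq_intros has_derivative_sum_squares finite_atLeastAtMost refl)+
       (simp del: sum.cl_ivl_Suc)
qed

text \<open>
  The cofactor drops out of \<open>Xh = Kh\<close> at a zero of \<open>h\<close>: the vector field is orthogonal to the
  gradient of \<open>h\<close> there. The common factor \<open>2\<close> of the gradient of \<open>h\<close> is cancelled.
\<close>

lemma tangency_on_S:
  assumes "vf_defined_on_S p q a R"
    and S: "((\<Sum>i=1..p+1. v i ^ 2) - a ^ 2) ^ 2 + (\<Sum>j=p+2..p+q+1. v j ^ 2) = 1"
  shows "2 * ((\<Sum>i=1..p+1. v i ^ 2) - a ^ 2) * (\<Sum>i=1..p+1. poly_eval v (R i) * v i)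
    + (\<Sum>j=p+2..p+q+1. poly_eval v (R j) * v j) = 0"
proof -
  let ?u = "(\<Sum>i=1..p+1. v i ^ 2) - a ^ 2"
  let ?r = "\<lambda>i. poly_eval v (R i)"
  obtain K where "vf_apply (p+q+1) R (h_poly p q a) = K * h_poly p q a"
    using assms(1) unfolding vf_defined_on_S_def by blast
  then have "poly_eval v (vf_apply (p+q+1) R (h_poly p q a))
      = poly_eval v K * poly_eval v (h_poly p q a)"
    by simp
  also have "poly_eval v (h_poly p q a) = 0"
    using S by (simp only: poly_eval_h_poly)
  finally have "0 = (\<Sum>i=1..p+q+1. ?r i * ((if i \<in> {1..p+1} then 4 * ?u * v i else 0)
      + (if i \<in> {p+2..p+q+1} then 2 * v i else 0)))"
    unfolding vf_apply_def poly_eval_sum poly_eval_mult poly_eval_partial_deriv_h_poly by simp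
  also have "{1..p+q+1} = {1..p+1} \<union> {p+2..p+q+1}"
    by auto
  also have "(\<Sum>i\<in>\<dots>. ?r i * ((if i \<in> {1..p+1} then 4 * ?u * v i else 0)
      + (if i \<in> {p+2..p+q+1} then 2 * v i else 0)))
    = (\<Sum>i=1..p+1. 4 * ?u * (?r i * v i)) + (\<Sum>i=p+2..p+q+1. 2 * (?r i * v i))"
    by (subst sum.union_disjoint)
       (auto simp del: sum.cl_ivl_Suc intro!: sum.cong arg_cong2[of _ _ _ _ "(+)"])
  also have "\<dots> = 4 * ?u * (\<Sum>i=1..p+1. ?r i * v i) + 2 * (\<Sum>j=p+2..p+q+1. ?r j * v j)"
    by (simp only: sum_distrib_left)
  finally show ?thesis
    by linarith
qed

section \<open>Comparison of coefficients at points with two nonzero coordinates\<close>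

lemma sum_two_point:
  fixes f :: "nat \<Rightarrow> real" 
  assumes "finite A" "i \<noteq> j" "\<And>k. k \<noteq> i \<Longrightarrow> k \<noteq> j \<Longrightarrow> f k = 0"
  shows "sum f A = (if i \<in> A then f i else 0) + (if j \<in> A then f j else 0)"
proof -
  have "sum f A = (\<Sum>k\<in>A. (if k = i then f k else 0) + (if k = j then f k else 0))"
    using assms by (intro sum.cong) auto
  then show ?thesis
    using assms(1) by (simp add: sum.distrib)
qed

lemma sum_two_fun_upd:
  fixes g :: "nat \<Rightarrow> real \<Rightarrow> real"
  assumes "finite A" "i \<noteq> j" "\<And>k. g k 0 = 0"
  shows "(\<Sum>k\<in>A. g k (((\<lambda>_. 0)(i := x, j := y)) k))
    = (if i \<in> A then g i x else 0) + (if j \<in> A then g j y else 0)"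
  by (subst sum_two_point[of A i j]) (use assms in auto)

theorem proposition3p2:
  fixes p q n :: nat and a :: real
    and R :: "nat \<Rightarrow> rpoly" and c :: "nat \<Rightarrow> nat \<Rightarrow> real"
  assumes "p > 0" and "q > 0" and "n = p + q + 1" and "a > 1"
    and "polynomial_vector_field n R"
    and "vf_degree n R = 1"
    and "vf_defined_on_S p q a R"
    and "\<And>i. i \<in> {1..n} \<Longrightarrow> R i = (\<Sum>j=1..n. Cst (c i j) * Var j) + Cst (c i 0)"
  shows "(\<forall>i\<in>{1..p+1}. \<forall>j\<in>{1..p+1}. c j i = - c i j) \<and> (\<forall>i\<in>{1..n}. c i 0 = 0)"
proof -
  have n: "n = p + q + 1" by fact
  \<comment> \<open>Tangency at the point \<open>s e\<^sub>i + t e\<^sub>j\<close>; the case distinctions record in which of the two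
      blocks of coordinates \<open>i\<close> and \<open>j\<close> lie.\<close>
  have two: "2 * (((if i \<in> {1..p+1} then s ^ 2 else 0) + (if j \<in> {1..p+1} then t ^ 2 else 0)) - a ^ 2)
       * ((if i \<in> {1..p+1} then (c i i * s + c i j * t + c i 0) * s else 0)
          + (if j \<in> {1..p+1} then (c j i * s + c j j * t + c j 0) * t else 0))
      + ((if i \<in> {p+2..p+q+1} then (c i i * s + c i j * t + c i 0) * s else 0)
          + (if j \<in> {p+2..p+q+1} then (c j i * s + c j j * t + c j 0) * t else 0)) = 0"
    if ij: "i \<noteq> j" "i \<in> {1..n}" "j \<in> {1..n}"
      and S: "(((if i \<in> {1..p+1} then s ^ 2 else 0) + (if j \<in> {1..p+1} then t ^ 2 else 0)) - a ^ 2) ^ 2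
        + ((if i \<in> {p+2..p+q+1} then s ^ 2 else 0) + (if j \<in> {p+2..p+q+1} then t ^ 2 else 0)) = 1"
    for i j s t
  proof -
    let ?v = "(\<lambda>_. 0)(i := s, j := t) :: nat \<Rightarrow> real"
    have sq: "(\<Sum>k\<in>A. ?v k ^ 2)
        = (if i \<in> A then s ^ 2 else 0) + (if j \<in> A then t ^ 2 else 0)"
      if "finite A" for A
      using sum_two_fun_upd[of A i j "\<lambda>_ z. z ^ 2" s t] ij that by simp
    have lin: "(\<Sum>k\<in>A. f k * ?v k) = (if i \<in> A then f i * s else 0) + (if j \<in> A then f j * t else 0)"
      if "finite A" for A f
      using sum_two_fun_upd[of A i j "\<lambda>k z. f k * z" s t] ij that by simp
    have R: "poly_eval ?v (R k) = c k i * s + c k j * t + c k 0" if "k \<in> {1..n}" for k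
    proof -
      have "poly_eval ?v (R k) = (\<Sum>l=1..n. c k l * ?v l) + c k 0"
        using assms(8)[OF that] by (simp del: sum.cl_ivl_Suc fun_upd_apply)
      then show ?thesis
        unfolding lin[OF finite_atLeastAtMost] using ij by simp
    qed
    show ?thesis
      using tangency_on_S[OF assms(7), of ?v] S
      unfolding sq[OF finite_atLeastAtMost] lin[OF finite_atLeastAtMost]
        R[OF ij(2)] R[OF ij(3)]
      by blast
  qed
  have u_eq_1: "(c i i * s + c i j * t + c i 0) * s + (c j i * s + c j j * t + c j 0) * t = 0"
    if "i \<noteq> j" "i \<in> {1..p+1}" "j \<in> {1..p+1}" and "s ^ 2 + t ^ 2 = a ^ 2 + 1" for i j s t
    using two[of i j s t] that n by auto
  have u_eq_0: "(c j 1 * s + c j j * t + c j 0) * t = 0"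
    if "j \<in> {p+2..n}" and "s ^ 2 = a ^ 2" and "t ^ 2 = 1" for j s t
    using two[of 1 j s t] that n by auto
  have diag: "c i i = 0 \<and> c i 0 = 0" if i: "i \<in> {1..p+1}" for i
  proof -
    define r where "r = sqrt (a ^ 2 + 1)"
    have r: "r ^ 2 = a ^ 2 + 1" "r > 0"
      by (simp_all add: r_def add_nonneg_pos)
    \<comment> \<open>The second coordinate is set to \<open>0\<close>; it exists because \<open>p + 1 \<ge> 2\<close>.\<close>
    obtain j where j: "j \<noteq> i" "j \<in> {1..p+1}"
      using \<open>p > 0\<close> that[of "if i = 1 then 2 else 1"] by auto
    have "(c i i * r + c i 0) * r = 0" "(c i i * (- r) + c i 0) * (- r) = 0"
      using u_eq_1[of i j r 0] u_eq_1[of i j "- r" 0] i j r by auto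
    then have "c i i * r + c i 0 = 0" "c i i * (- r) + c i 0 = 0"
      using r(2) by (simp_all del: mult_minus_right)
    moreover from this have "c i 0 = 0"
      by linarith
    ultimately show ?thesis
      using r(2) by auto
  qed
  have skew: "c j i = - c i j" if "i \<in> {1..p+1}" "j \<in> {1..p+1}" for i j
  proof (cases "i = j")
    case True
    then show ?thesis using diag that by simp
  next
    case False
    \<comment> \<open>The point \<open>b e\<^sub>i + b e\<^sub>j\<close> lies on the sphere \<open>|x|\<^sup>2 = a\<^sup>2 + 1\<close>, and by \<open>diag\<close> only the
        mixed terms survive there.\<close>
    define b where "b = sqrt ((a ^ 2 + 1) / 2)"
    have b: "b ^ 2 = (a ^ 2 + 1) / 2" "b > 0"
      by (simp_all add: b_def add_nonneg_pos)
    have "(c i j * b) * b + (c j i * b) * b = 0"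
      using u_eq_1[OF False that, of b b] diag that b by simp
    then have "(c i j + c j i) * b * b = 0"
      by (simp add: algebra_simps)
    then show ?thesis
      using b(2) by simp
  qed
  have "c j 0 = 0" if j: "j \<in> {p+2..n}" for j
    \<comment> \<open>The signs of \<open>a\<close> eliminate \<open>c j 1\<close>, those of \<open>1\<close> eliminate \<open>c j j\<close>.\<close>
    using u_eq_0[OF j, of a 1] u_eq_0[OF j, of "- a" 1]
      u_eq_0[OF j, of a "- 1"] u_eq_0[OF j, of "- a" "- 1"] by simp
  moreover have "{1..n} = {1..p+1} \<union> {p+2..n}"
    using n by auto
  ultimately show ?thesis
    using diag skew by blast
qed

end
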